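(* Let $\mu>0$, $\nu>0$ be constants and $\theta\in(0,1)$. Consider Burgers' equation $$u_t-\mu u_{xx}+\nu u u_x=f(x,t)\ \text{ in }(0,1)\times\mathbb{R}_{+},\qquad u(0,t)=0,\ u(1,t)=d(t),\qquad u(x,0)=u_0(x).$$ This system is, in $L^2$-norm, EISS with respect to boundary disturbances $d\in\mathcal{H}^{1+\frac{\theta}{2}}(\mathbb{R}_{\geq 0})$ satisfying $\sup_{t\in\mathbb{R}_{\geq 0}}|d(t)|<\frac{\mu}{\nu}$, and EiISS with respect to in-domain disturbances $f\in\mathcal{H}^{\theta,\frac{\theta}{2}}([0,1]\times\mathbb{R}_{\geq 0})$; and, for all such $d,f$ and every admissible initial datum $u_0$, the solution $u$ satisfies, for any $t>0$ and every $\varepsilon\in(0,\mu)$, $$\|u(\cdot,t)\|^2\leq 2\|u_0\|^2e^{-(\mu-\varepsilon)t}+2\max_{s\in[0,t]}|d(s)|^2+\frac{2}{\varepsilon}\int_0^t\|f(\cdot,s)\|^2\,\mathrm{d}s.$$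
   Context: Notation: $\mathbb{R}_+=(0,+\infty)$, $\mathbb{R}_{\ge0}=[0,+\infty)$, and $\|\cdot\|=\|\cdot\|_{L^2(0,1)}$. The spaces $\mathcal{H}^{l}$ and $\mathcal{H}^{l,\frac l2}$ ($l>0$ non-integer) are the usual (parabolic) Hölder spaces: $\mathcal{H}^{2+\theta}([0,1])$ consists of $C^2$ functions whose second derivative is $\theta$-Hölder; $\mathcal{H}^{1+\frac\theta2}(\mathbb{R}_{\ge0})$ consists of $C^1$ functions, bounded with bounded derivative, whose derivative is $\frac\theta2$-Hölder; $\mathcal{H}^{\theta,\frac\theta2}([0,1]\times\mathbb{R}_{\ge0})$ consists of bounded functions that are $\theta$-Hölder in $x$ and $\frac\theta2$-Hölder in $t$ (uniformly). Standing assumptions: $u_0\in\mathcal{H}^{2+\theta}([0,1])$, $f\in\mathcal{H}^{\theta,\frac\theta2}([0,1]\times\mathbb{R}_{\ge0})$, $d\in\mathcal{H}^{1+\frac\theta2}(\mathbb{R}_{\ge0})$, and the compatibility conditions $u_0(0)=u_0''(0)=u_0(1)=u_0''(1)=d(0)=d'(0)=f(0,0)=f(1,0)=0$ hold (an initial datum is admissible if it satisfies these conditions). The solution $u$ is the unique classical solution in $C^{2,1}([0,1]\times\mathbb{R}_{\ge0})$. Comparison functions: $\mathcal K$ is the set of continuous strictly increasing $\gamma:\mathbb{R}_{\ge0}\to\mathbb{R}_{\ge0}$ with $\gamma(0)=0$; $\mathcal K_\infty$ is the set of $\gamma\in\mathcal K$ with $\lim_{s\to\infty}\gamma(s)=\infty$;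 $\mathcal{L}$ is the set of continuous strictly decreasing $\gamma:\mathbb{R}_{\ge0}\to\mathbb{R}_{\ge0}$ with $\lim_{s\to\infty}\gamma(s)=0$; $\mathcal{KL}$ is the set of $\beta:\mathbb{R}_{\ge0}\times\mathbb{R}_{\ge0}\to\mathbb{R}_{\ge0}$ with $\beta(\cdot,t)\in\mathcal K$ for all $t\in\mathbb{R}_{\ge0}$ and $\beta(s,\cdot)\in\mathcal L$ for all $s\in\mathbb{R}_+$. Definition: the system is ISS with respect to boundary disturbances $d$ and integral input-to-state stable (iISS) with respect to in-domain disturbances $f$, in $L^q$-norm ($2\le q\le+\infty$), if there exist $\beta\in\mathcal{KL}$, $\vartheta\in\mathcal K_\infty$ and $\gamma_1,\gamma_2\in\mathcal K$ such that its solutions satisfy, for all $t\ge0$, $$\|u(\cdot,t)\|_{L^q(0,1)}\le\beta(\|u_0\|_{L^q(0,1)},t)+\gamma_1\Big(\max_{s\in[0,t]}|d(s)|\Big)+\vartheta\Big(\int_0^t\gamma_2(\|f(\cdot,s)\|)\,\mathrm{d}s\Big).$$ It is EISS with respect to $d$ and EiISS (exponentially iISS) with respect to $f$ if moreover there exist $\beta'\in\mathcal K_\infty$ and a constant $\lambda>0$ such that $\beta(\|u_0\|_{L^q(0,1)},t)\le\beta'(\|u_0\|_{L^q(0,1)})e^{-\lambda t}$. *)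

theory Defs
  imports "HOL-Analysis.Analysis"
begin

text \<open>
  Functions on \<open>[0,1]\<close>, on \<open>[0,\<infinity>)\<close> or on \<open>[0,1] \<times> [0,\<infinity>)\<close> are total functions on the reals whose
  values outside the domain are irrelevant; derivatives are therefore taken within the domain
  (one-sided at its boundary points).
\<close>

definition deriv_within :: "real set \<Rightarrow> (real \<Rightarrow> real) \<Rightarrow> real \<Rightarrow> real"
  where "deriv_within S g x = vector_derivative g (at x within S)"

definition Dx :: "(real \<Rightarrow> real \<Rightarrow> real) \<Rightarrow> real \<Rightarrow> real \<Rightarrow> real"
  where "Dx u x t = deriv_within {0..1} (\<lambda>y. u y t) x"

definition Dt :: "(real \<Rightarrow> real \<Rightarrow> real) \<Rightarrow> real \<Rightarrow> real \<Rightarrow> real"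
  where "Dt u x t = deriv_within {0..} (\<lambda>s. u x s) t"

definition C21 :: "(real \<Rightarrow> real \<Rightarrow> real) set"
  where "C21 = {u.
    (\<forall>t\<ge>0. (\<lambda>x. u x t) differentiable_on {0..1} \<and> (\<lambda>x. Dx u x t) differentiable_on {0..1}) \<and>
    (\<forall>x\<in>{0..1}. (\<lambda>t. u x t) differentiable_on {0..}) \<and>
    continuous_on ({0..1} \<times> {0..}) (\<lambda>(x, t). u x t) \<and>
    continuous_on ({0..1} \<times> {0..}) (\<lambda>(x, t). Dx u x t) \<and>
    continuous_on ({0..1} \<times> {0..}) (\<lambda>(x, t). Dx (Dx u) x t) \<and>
    continuous_on ({0..1} \<times> {0..}) (\<lambda>(x, t). Dt u x t)}"


subsection \<open>Hoelder spaces\<close>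

definition holder_on :: "real \<Rightarrow> real set \<Rightarrow> (real \<Rightarrow> real) \<Rightarrow> bool"
  where "holder_on \<alpha> S g \<longleftrightarrow> (\<exists>C. \<forall>x\<in>S. \<forall>y\<in>S. \<bar>g x - g y\<bar> \<le> C * \<bar>x - y\<bar> powr \<alpha>)"

text \<open>\<open>H\<^sup>2\<^sup>+\<^sup>\<alpha>([0,1])\<close>; continuity of the second derivative follows from its Hoelder continuity.\<close>

definition holder_2_space :: "real \<Rightarrow> (real \<Rightarrow> real) set"
  where "holder_2_space \<alpha> = {g.
    g differentiable_on {0..1} \<and>
    deriv_within {0..1} g differentiable_on {0..1} \<and>
    holder_on \<alpha> {0..1} (deriv_within {0..1} (deriv_within {0..1} g))}"

text \<open>\<open>H\<^sup>1\<^sup>+\<^sup>\<alpha>([0,\<infinity>))\<close>.\<close>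

definition holder_1_space :: "real \<Rightarrow> (real \<Rightarrow> real) set"
  where "holder_1_space \<alpha> = {g.
    g differentiable_on {0..} \<and>
    bounded (g ` {0..}) \<and>
    bounded (deriv_within {0..} g ` {0..}) \<and>
    holder_on \<alpha> {0..} (deriv_within {0..} g)}"

text \<open>The parabolic space with exponents \<open>\<alpha>\<close> in \<open>x\<close> and \<open>\<alpha>/2\<close> in \<open>t\<close> on \<open>[0,1] \<times> [0,\<infinity>)\<close>.\<close>

definition holder_par_space :: "real \<Rightarrow> (real \<Rightarrow> real \<Rightarrow> real) set"
  where "holder_par_space \<alpha> = {f.
    (\<exists>B. \<forall>x\<in>{0..1}. \<forall>t\<ge>0. \<bar>f x t\<bar> \<le> B) \<and>
    (\<exists>C. \<forall>t\<ge>0. \<forall>x\<in>{0..1}. \<forall>y\<in>{0..1}. \<bar>f x t - f y t\<bar> \<le> C * \<bar>x - y\<bar> powr \<alpha>) \<and>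
    (\<exists>C. \<forall>x\<in>{0..1}. \<forall>s\<ge>0. \<forall>t\<ge>0. \<bar>f x s - f x t\<bar> \<le> C * \<bar>s - t\<bar> powr (\<alpha> / 2))}"


subsection \<open>Burgers' equation\<close>

definition admissible_data ::
    "real \<Rightarrow> (real \<Rightarrow> real) \<Rightarrow> (real \<Rightarrow> real) \<Rightarrow> (real \<Rightarrow> real \<Rightarrow> real) \<Rightarrow> bool"
  where "admissible_data \<theta> u0 d f \<longleftrightarrow>
    u0 \<in> holder_2_space \<theta> \<and> d \<in> holder_1_space (\<theta> / 2) \<and> f \<in> holder_par_space \<theta> \<and>
    u0 0 = 0 \<and> deriv_within {0..1} (deriv_within {0..1} u0) 0 = 0 \<and>
    u0 1 = 0 \<and> deriv_within {0..1} (deriv_within {0..1} u0) 1 = 0 \<and>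
    d 0 = 0 \<and> deriv_within {0..} d 0 = 0 \<and>
    f 0 0 = 0 \<and> f 1 0 = 0"

definition burgers_solution ::
    "real \<Rightarrow> real \<Rightarrow> (real \<Rightarrow> real) \<Rightarrow> (real \<Rightarrow> real) \<Rightarrow> (real \<Rightarrow> real \<Rightarrow> real) \<Rightarrow>
     (real \<Rightarrow> real \<Rightarrow> real) \<Rightarrow> bool"
  where "burgers_solution \<mu> \<nu> u0 d f u \<longleftrightarrow>
    u \<in> C21 \<and>
    (\<forall>x\<in>{0<..<1}. \<forall>t>0.
       Dt u x t - \<mu> * Dx (Dx u) x t + \<nu> * u x t * Dx u x t = f x t) \<and>
    (\<forall>t\<ge>0. u 0 t = 0 \<and> u 1 t = d t) \<and>
    (\<forall>x\<in>{0..1}. u x 0 = u0 x)"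


subsection \<open>Comparison functions\<close>

definition class_K :: "(real \<Rightarrow> real) set"
  where "class_K = {\<gamma>. \<gamma> ` {0..} \<subseteq> {0..} \<and> continuous_on {0..} \<gamma> \<and>
    strict_mono_on {0..} \<gamma> \<and> \<gamma> 0 = 0}"

definition class_Kinf :: "(real \<Rightarrow> real) set"
  where "class_Kinf = {\<gamma> \<in> class_K. filterlim \<gamma> at_top at_top}"

definition class_L :: "(real \<Rightarrow> real) set"
  where "class_L = {\<gamma>. \<gamma> ` {0..} \<subseteq> {0..} \<and> continuous_on {0..} \<gamma> \<and>
    strict_antimono_on {0..} \<gamma> \<and> (\<gamma> \<longlongrightarrow> 0) at_top}"

definition class_KL :: "(real \<Rightarrow> real \<Rightarrow> real) set"
  where "class_KL = {\<beta>. (\<forall>t\<ge>0. (\<lambda>s. \<beta> s t) \<in> class_K) \<and> (\<forall>s>0. \<beta> s \<in> class_L)}"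


subsection \<open>Input-to-state stability\<close>

definition L2norm :: "(real \<Rightarrow> real) \<Rightarrow> real"
  where "L2norm g = sqrt (LINT x:{0<..<1}|lebesgue. (g x)\<^sup>2)"

text \<open>
  A system is the relation \<open>\<Sigma> u0 d f u\<close> between initial datum, boundary disturbance, in-domain
  disturbance and solution.  The maximum of \<open>\<bar>d\<bar>\<close> over \<open>[0,t]\<close> is written as a supremum; the two
  agree because the disturbances considered are continuous.
\<close>

definition ISS_iISS_L2_estimate ::
    "((real \<Rightarrow> real) \<Rightarrow> (real \<Rightarrow> real) \<Rightarrow> (real \<Rightarrow> real \<Rightarrow> real) \<Rightarrow> (real \<Rightarrow> real \<Rightarrow> real) \<Rightarrow> bool) \<Rightarrow>
     (real \<Rightarrow> real \<Rightarrow> real) \<Rightarrow> (real \<Rightarrow> real) \<Rightarrow> (real \<Rightarrow> real) \<Rightarrow> (real \<Rightarrow> real) \<Rightarrow> bool"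
  where "ISS_iISS_L2_estimate \<Sigma> \<beta> \<gamma>1 \<eta> \<gamma>2 \<longleftrightarrow>
    (\<forall>u0 d f u. \<Sigma> u0 d f u \<longrightarrow> (\<forall>t\<ge>0.
       L2norm (\<lambda>x. u x t) \<le>
         \<beta> (L2norm u0) t + \<gamma>1 (SUP s\<in>{0..t}. \<bar>d s\<bar>) +
         \<eta> (LINT s:{0..t}|lebesgue. \<gamma>2 (L2norm (\<lambda>x. f x s)))))"

definition EISS_EiISS_L2 ::
    "((real \<Rightarrow> real) \<Rightarrow> (real \<Rightarrow> real) \<Rightarrow> (real \<Rightarrow> real \<Rightarrow> real) \<Rightarrow> (real \<Rightarrow> real \<Rightarrow> real) \<Rightarrow> bool) \<Rightarrow> bool"
  where "EISS_EiISS_L2 \<Sigma> \<longleftrightarrow>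
    (\<exists>\<beta>\<in>class_KL. \<exists>\<eta>\<in>class_Kinf. \<exists>\<gamma>1\<in>class_K. \<exists>\<gamma>2\<in>class_K.
       ISS_iISS_L2_estimate \<Sigma> \<beta> \<gamma>1 \<eta> \<gamma>2 \<and>
       (\<exists>\<beta>'\<in>class_Kinf. \<exists>c>0. \<forall>s\<ge>0. \<forall>t\<ge>0. \<beta> s t \<le> \<beta>' s * exp (- c * t)))"

end

theory Submission
  imports Defs
begin

text \<open>
  Fix a final time \<open>T\<close>, let \<open>D\<close> be the maximum of \<open>\<bar>d\<bar>\<close> on \<open>[0,T]\<close>, and split the solution by
  truncation of its values: \<open>u = w + v\<close>, where \<open>w\<close> is the nearest point of \<open>[-D,D]\<close> to \<open>u\<close> and
  \<open>v = excess D u\<close> measures how far \<open>u\<close> leaves that interval.  Then \<open>\<bar>w\<bar> \<le> D\<close>, hence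
  \<open>u\<^sup>2 \<le> 2 v\<^sup>2 + 2 D\<^sup>2\<close>, and it remains to show that the energy \<open>E(t) = \<integral> v\<^sup>2 dx\<close> decays, up to the
  contribution of \<open>f\<close>.

  The excess vanishes at both ends of \<open>[0,1]\<close>, because the boundary values of \<open>u\<close> lie in \<open>[-D,D]\<close>.
  As \<open>v\<^sup>2\<close> has derivative \<open>2 v u\<^sub>t\<close> in time, testing the equation with \<open>v\<close> gives three terms.
  The convection term \<open>\<integral> v u u\<^sub>x dx\<close> is zero (\<open>convection_excess_zero\<close>): a primitive of
  \<open>r \<mapsto> excess D r * r\<close> is constant on \<open>[-D,D]\<close> and so takes the same value at both ends.
  The diffusion term satisfies \<open>\<integral> v u\<^sub>x\<^sub>x dx \<le> - \<integral> v\<^sup>2 dx\<close> (\<open>diffusion_excess_le\<close>): integration by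
  parts, then Poincare's inequality for \<open>v\<close>.  Young's inequality bounds the source term by
  \<open>2 \<integral> f v dx \<le> \<epsilon> E + (1/\<epsilon>) \<integral> f\<^sup>2 dx\<close>.  Together,
  \<open>E' \<le> - (\<mu> - \<epsilon>) E + (1/\<epsilon>) \<integral> f\<^sup>2 dx\<close>,
  and Gronwall's lemma gives the explicit bound on the squared norm (\<open>L2_estimate\<close>).

  The stability estimate is this bound with \<open>\<epsilon> = \<mu>/2\<close>, after taking square roots of the three
  summands separately.
\<close>

section \<open>Excess of a real number over an interval\<close>

text \<open>This is \<open>r\<close> minus its projection onto \<open>[-D,D]\<close>, provided \<open>D \<ge> 0\<close>.\<close>

definition excess :: "real \<Rightarrow> real \<Rightarrow> real"
  where "excess D r = max 0 (r - D) - max 0 (- r - D)"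

lemma has_real_derivative_quadratic_remainder:
  fixes g :: "real \<Rightarrow> real"
  assumes "\<And>y. \<bar>g y - g r - m * (y - r)\<bar> \<le> C * (y - r)\<^sup>2"
  shows "(g has_real_derivative m) (at r)"
proof -
  have lim: "((\<lambda>y. C * \<bar>y - r\<bar>) \<longlongrightarrow> 0) (at r)"
    by (rule tendsto_eq_intros refl | simp)+
  have "((\<lambda>y. (g y - g r) / (y - r) - m) \<longlongrightarrow> 0) (at r)"
  proof (rule Lim_null_comparison[OF _ lim], unfold eventually_at_filter, intro always_eventually allI impI)
    fix y assume "y \<noteq> r"
    then have "\<bar>(g y - g r) / (y - r) - m\<bar> = \<bar>g y - g r - m * (y - r)\<bar> / \<bar>y - r\<bar>"
      by (simp add: field_simps flip: abs_divide)
    also have "\<dots> \<le> C * (y - r)\<^sup>2 / \<bar>y - r\<bar>"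
      by (intro divide_right_mono assms) simp
    also have "\<dots> = C * \<bar>y - r\<bar>"
      using \<open>y \<noteq> r\<close> by (simp add: power2_eq_square field_simps abs_mult_self_eq)
    finally show "norm ((g y - g r) / (y - r) - m) \<le> C * \<bar>y - r\<bar>" by simp
  qed
  then show ?thesis
    by (simp add: has_field_derivative_iff LIM_zero_iff)
qed

lemma has_real_derivative_pos_part_sq:
  "((\<lambda>r::real. (max 0 (r - c))\<^sup>2) has_real_derivative 2 * max 0 (r - c)) (at r)"
proof (rule has_real_derivative_quadratic_remainder[where C = 1])
  fix y
  show "\<bar>(max 0 (y - c))\<^sup>2 - (max 0 (r - c))\<^sup>2 - 2 * max 0 (r - c) * (y - r)\<bar> \<le> 1 * (y - r)\<^sup>2"
  proof -
    define a b where "a = y - c" "b = r - c"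
    have yr: "y - r = a - b" by (simp add: a_b_def)
    consider "a \<ge> 0" "b \<ge> 0" | "a \<ge> 0" "b < 0" | "a < 0" "b \<ge> 0" | "a < 0" "b < 0" by linarith
    then show ?thesis
    proof cases
      case 2
      then have "a\<^sup>2 \<le> (a - b)\<^sup>2" by (intro power_mono) auto
      with 2 show ?thesis unfolding yr by (simp flip: a_b_def)
    next
      case 3
      have "- b\<^sup>2 - 2 * b * (a - b) = b\<^sup>2 - 2 * (a * b)" by (simp add: power2_eq_square algebra_simps)
      moreover have "(a - b)\<^sup>2 = a\<^sup>2 + b\<^sup>2 - 2 * (a * b)" by (simp add: power2_diff)
      moreover have "a * b \<le> 0" using 3 by (simp add: mult_nonpos_nonneg)
      moreover have "0 \<le> a\<^sup>2" "0 \<le> b\<^sup>2" by simp_all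
      ultimately have "\<bar>- b\<^sup>2 - 2 * b * (a - b)\<bar> \<le> (a - b)\<^sup>2" by linarith
      with 3 show ?thesis unfolding yr by (simp flip: a_b_def)
    next
      case 1
      moreover have "a\<^sup>2 - b\<^sup>2 - 2 * b * (a - b) = (a - b)\<^sup>2"
        by (simp add: power2_eq_square algebra_simps)
      ultimately show ?thesis unfolding yr by (simp flip: a_b_def)
    qed (simp flip: a_b_def)
  qed
qed

lemma has_real_derivative_pos_part_sq_neg:
  "((\<lambda>r::real. (max 0 (- r - c))\<^sup>2) has_real_derivative - 2 * max 0 (- r - c)) (at r)"
  using DERIV_chain2[OF has_real_derivative_pos_part_sq[of c "- r"] DERIV_minus[OF DERIV_ident]]
  by simp

lemma excess_sq: "D \<ge> 0 \<Longrightarrow> (excess D r)\<^sup>2 = (max 0 (r - D))\<^sup>2 + (max 0 (- r - D))\<^sup>2"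
  by (cases "r \<ge> 0") (auto simp: excess_def max_def power2_eq_square algebra_simps)

text \<open>
  The excess itself has kinks at \<open>D\<close> and \<open>-D\<close>, but its square is continuously differentiable.
  Therefore the energy \<open>\<integral> (excess D u)\<^sup>2 dx\<close> can be differentiated in time without any smoothing.
\<close>

lemma has_real_derivative_excess_sq:
  assumes "D \<ge> 0"
  shows "((\<lambda>r. (excess D r)\<^sup>2) has_real_derivative 2 * excess D r) (at r)"
  unfolding excess_sq[OF assms]
  by (rule DERIV_cong[OF DERIV_add[OF has_real_derivative_pos_part_sq has_real_derivative_pos_part_sq_neg]])
     (simp add: excess_def)

lemma continuous_on_excess [continuous_intros]:
  "continuous_on S g \<Longrightarrow> continuous_on S (\<lambda>x. excess D (g x))"
  unfolding excess_def by (intro continuous_intros)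

text \<open>
  Integration by parts against a second derivative needs a continuously differentiable test
  function of the solution.  The kinks are removed by replacing the jump of the derivative at \<open>D\<close>
  with a linear ramp from 0 to 1 on \<open>[D, D + \<delta>]\<close>, and symmetrically at \<open>-D\<close>.  The ramp is a difference
  of two positive parts, so its primitive is a difference of two squared positive parts.
\<close>

lemma smooth_excess:
  assumes "D \<ge> 0" and "\<delta> > 0"
  obtains P k where "\<And>r. (P has_real_derivative k r) (at r)" "continuous_on UNIV k"
    "\<And>r. 0 \<le> k r" "\<And>r. k r \<le> 1" "\<And>r. \<bar>r\<bar> \<le> D \<Longrightarrow> P r = 0" "\<And>r. \<bar>excess D r - P r\<bar> \<le> \<delta>"
proof
  define p where "p c r = max 0 (r - c)" for c r :: real
  define P where "P r = ((p D r)\<^sup>2 - (p (D + \<delta>) r)\<^sup>2) / (2 * \<delta>) -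
      ((p D (- r))\<^sup>2 - (p (D + \<delta>) (- r))\<^sup>2) / (2 * \<delta>)" for r
  define k where "k r = (p D r - p (D + \<delta>) r + p D (- r) - p (D + \<delta>) (- r)) / \<delta>" for r
  show "(P has_real_derivative k r) (at r)" for r
    unfolding P_def k_def p_def
    by (rule DERIV_cong[OF DERIV_diff[OF
          DERIV_cdivide[OF DERIV_diff[OF has_real_derivative_pos_part_sq has_real_derivative_pos_part_sq]]
          DERIV_cdivide[OF DERIV_diff[OF has_real_derivative_pos_part_sq_neg
            has_real_derivative_pos_part_sq_neg]]]])
       (use \<open>\<delta> > 0\<close> in \<open>simp add: field_simps\<close>)
  show "continuous_on UNIV k"
    unfolding k_def p_def by (intro continuous_intros) (use assms in auto)
  show "0 \<le> k r" "k r \<le> 1" for r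
    using assms unfolding k_def zero_le_divide_iff divide_le_eq_1_pos[OF \<open>\<delta> > 0\<close>]
    by (auto simp: p_def)
  show "P r = 0" if "\<bar>r\<bar> \<le> D" for r
    using assms that by (auto simp: P_def p_def max_def)
  have pos: "\<bar>p D r - ((p D r)\<^sup>2 - (p (D + \<delta>) r)\<^sup>2) / (2 * \<delta>)\<bar> \<le> \<delta>" for r
  proof -
    define s where "s = r - D"
    consider "s \<le> 0" | "0 \<le> s" "s \<le> \<delta>" | "s \<ge> \<delta>" by linarith
    then show ?thesis
    proof cases
      case 2
      then have "s\<^sup>2 \<le> 2 * \<delta> * s" "0 \<le> s\<^sup>2" by (simp_all add: power2_eq_square mult_right_mono)
      then have "0 \<le> s\<^sup>2 / (2 * \<delta>)" "s\<^sup>2 / (2 * \<delta>) \<le> s"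
        using assms by (simp_all add: field_simps)
      moreover have "p D r = s" "p (D + \<delta>) r = 0" using 2 by (auto simp: p_def s_def)
      then have "p D r - ((p D r)\<^sup>2 - (p (D + \<delta>) r)\<^sup>2) / (2 * \<delta>) = s - s\<^sup>2 / (2 * \<delta>)" by simp
      ultimately show ?thesis using 2 by linarith
    next
      case 3
      then have ps: "p D r = s" "p (D + \<delta>) r = s - \<delta>" using assms by (auto simp: p_def s_def)
      have "p D r - ((p D r)\<^sup>2 - (p (D + \<delta>) r)\<^sup>2) / (2 * \<delta>) = \<delta> / 2"
        unfolding ps using assms by (simp add: field_simps power2_eq_square)
      then show ?thesis using assms by linarith
    qed (use assms in \<open>auto simp: p_def s_def\<close>)
  qed
  show "\<bar>excess D r - P r\<bar> \<le> \<delta>" for r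
  proof (cases "r \<ge> 0")
    case True
    then have "p D (- r) = 0" "p (D + \<delta>) (- r) = 0" using assms by (auto simp: p_def)
    then show ?thesis using pos[of r] by (simp add: excess_def P_def p_def)
  next
    case False
    then have "p D r = 0" "p (D + \<delta>) r = 0" using assms by (auto simp: p_def)
    then show ?thesis using pos[of "- r"] by (simp add: excess_def P_def p_def abs_minus_commute)
  qed
qed

lemma excess_bounds:
  assumes "D \<ge> 0"
  shows "r\<^sup>2 \<le> 2 * (excess D r)\<^sup>2 + 2 * D\<^sup>2" "(excess D r)\<^sup>2 \<le> r\<^sup>2"
proof -
  have "\<bar>r - excess D r\<bar> \<le> D" using assms by (auto simp: excess_def max_def)
  then have "(r - excess D r)\<^sup>2 \<le> D\<^sup>2" by (metis abs_ge_zero power2_abs power_mono)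
  \<comment> \<open>The parallelogram law for the two summands \<open>excess D r\<close> and \<open>r - excess D r\<close>.\<close>
  moreover have "r\<^sup>2 + (r - 2 * excess D r)\<^sup>2 = 2 * (excess D r)\<^sup>2 + 2 * (r - excess D r)\<^sup>2"
    by (simp add: power2_eq_square algebra_simps)
  moreover have "0 \<le> (r - 2 * excess D r)\<^sup>2" by simp
  ultimately show "r\<^sup>2 \<le> 2 * (excess D r)\<^sup>2 + 2 * D\<^sup>2" by linarith
  show "(excess D r)\<^sup>2 \<le> r\<^sup>2"
    unfolding abs_le_square_iff[symmetric] using assms by (auto simp: excess_def max_def)
qed

section \<open>Diffusion and convection tested with the excess\<close>

lemma integral_square_le_unit_interval:
  fixes h :: "real \<Rightarrow> real"
  assumes h: "continuous_on {0..1} h" and x: "x \<in> {0..1}"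
  shows "(integral {0..x} h)\<^sup>2 \<le> integral {0..1} (\<lambda>y. (h y)\<^sup>2)"
proof -
  define c where "c = integral {0..x} h"
  have hx: "continuous_on {0..x} h" using h x by (auto intro: continuous_on_subset)
  have i1: "h integrable_on {0..x}" "(\<lambda>y. (h y)\<^sup>2) integrable_on {0..x}"
    by (intro integrable_continuous_real continuous_intros hx)+
  \<comment> \<open>Cauchy-Schwarz as nonnegativity of a square.  Subtracting the integral \<open>c\<close> instead of
      the mean \<open>c / x\<close> avoids a division by \<open>x\<close> and suffices because \<open>x \<le> 1\<close>.\<close>
  have "0 \<le> integral {0..x} (\<lambda>y. (h y - c)\<^sup>2)"
    by (intro integral_nonneg integrable_continuous_real continuous_intros hx) simp
  also have "(\<lambda>y. (h y - c)\<^sup>2) = (\<lambda>y. (h y)\<^sup>2 - 2 * c * h y + c\<^sup>2)"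
    by (simp add: power2_diff algebra_simps)
  also have "integral {0..x} \<dots> = integral {0..x} (\<lambda>y. (h y)\<^sup>2) - 2 * c * c + x *\<^sub>R c\<^sup>2"
    using x i1 unfolding c_def
    by (intro integral_unique has_integral_add has_integral_diff has_integral_mult_right integrable_integral)
       (use has_integral_const_real[of "(integral {0..x} h)\<^sup>2" 0 x] in auto)
  finally have "2 * c\<^sup>2 - c\<^sup>2 * x \<le> integral {0..x} (\<lambda>y. (h y)\<^sup>2)"
    by (simp add: power2_eq_square algebra_simps)
  moreover have "c\<^sup>2 * x \<le> c\<^sup>2 * 1" using x by (intro mult_left_mono) auto
  moreover have "integral {0..x} (\<lambda>y. (h y)\<^sup>2) \<le> integral {0..1} (\<lambda>y. (h y)\<^sup>2)"
    using x by (intro integral_subset_le i1 integrable_continuous_real continuous_intros h) auto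
  ultimately show ?thesis unfolding c_def by linarith
qed

text \<open>
  Integration by parts turns the left-hand side into \<open>- \<integral> k(w) w'\<^sup>2 dx\<close>.  The composition \<open>P(w)\<close> has
  derivative \<open>k(w) w'\<close> and vanishes at 0, so Poincare's inequality gives
  \<open>P(w)\<^sup>2 \<le> \<integral> k(w)\<^sup>2 w'\<^sup>2 dx\<close> at every point, and \<open>k\<^sup>2 \<le> k\<close> because \<open>k\<close> takes values in \<open>[0,1]\<close>.
\<close>

lemma diffusion_C1_le:
  fixes P k w w' w'' :: "real \<Rightarrow> real"
  assumes P: "\<And>r. (P has_real_derivative k r) (at r)" and k: "continuous_on UNIV k"
    and k01: "\<And>r. 0 \<le> k r" "\<And>r. k r \<le> 1"
    and w: "\<And>x. x \<in> {0..1} \<Longrightarrow> (w has_real_derivative w' x) (at x within {0..1})"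
    and w': "\<And>x. x \<in> {0..1} \<Longrightarrow> (w' has_real_derivative w'' x) (at x within {0..1})"
    and w'': "continuous_on {0..1} w''"
    and bc: "P (w 0) = 0" "P (w 1) = 0"
  shows "integral {0..1} (\<lambda>x. P (w x) * w'' x) \<le> - integral {0..1} (\<lambda>x. (P (w x))\<^sup>2)"
proof -
  have cw: "continuous_on {0..1} w" "continuous_on {0..1} w'"
    using DERIV_continuous_on[OF w] DERIV_continuous_on[OF w'] by simp_all
  have ck: "continuous_on {0..1} (\<lambda>x. k (w x))"
    using continuous_on_compose2[OF k cw(1)] by simp
  have Pw: "((\<lambda>x. P (w x)) has_real_derivative k (w x) * w' x) (at x within {0..1})"
    if "x \<in> {0..1}" for x
    using DERIV_chain2[OF P w[OF that]] .
  have cP: "continuous_on {0..1} (\<lambda>x. P (w x))"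
    using Pw by (rule DERIV_continuous_on)
  note ci = cw ck cP w''
  have "((\<lambda>x. k (w x) * w' x * w' x + w'' x * P (w x)) has_integral P (w 1) * w' 1 - P (w 0) * w' 0) {0..1}"
    by (rule fundamental_theorem_of_calculus)
       (use DERIV_mult[OF Pw w'] in \<open>auto simp: has_real_derivative_iff_has_vector_derivative\<close>)
  then have "integral {0..1} (\<lambda>x. k (w x) * w' x * w' x + w'' x * P (w x)) = 0"
    by (simp add: integral_unique bc)
  moreover have "integral {0..1} (\<lambda>x. k (w x) * w' x * w' x + w'' x * P (w x)) =
      integral {0..1} (\<lambda>x. k (w x) * w' x * w' x) + integral {0..1} (\<lambda>x. w'' x * P (w x))"
    by (intro integral_add integrable_continuous_real continuous_intros ci)
  ultimately have parts: "integral {0..1} (\<lambda>x. P (w x) * w'' x) =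
      - integral {0..1} (\<lambda>x. k (w x) * w' x * w' x)"
    by (simp add: mult.commute)
  have pt: "(P (w x))\<^sup>2 \<le> integral {0..1} (\<lambda>x. k (w x) * w' x * w' x)" if x: "x \<in> {0..1}" for x
  proof -
    have "((\<lambda>x. P (w x)) has_real_derivative k (w y) * w' y) (at y within {0..x})" if "y \<in> {0..x}" for y
      using x that by (intro has_field_derivative_subset[OF Pw]) auto
    then have "((\<lambda>y. k (w y) * w' y) has_integral P (w x) - P (w 0)) {0..x}"
      using x by (intro fundamental_theorem_of_calculus)
        (auto simp flip: has_real_derivative_iff_has_vector_derivative)
    then have "(P (w x))\<^sup>2 = (integral {0..x} (\<lambda>y. k (w y) * w' y))\<^sup>2"
      by (simp add: integral_unique bc)
    also have "\<dots> \<le> integral {0..1} (\<lambda>y. (k (w y) * w' y)\<^sup>2)"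
      by (intro integral_square_le_unit_interval continuous_intros ci x)
    also have "\<dots> \<le> integral {0..1} (\<lambda>x. k (w x) * w' x * w' x)"
    proof (intro integral_le integrable_continuous_real continuous_intros ci)
      fix y
      have "k (w y) * (k (w y) * (w' y)\<^sup>2) \<le> 1 * (k (w y) * (w' y)\<^sup>2)"
        by (intro mult_right_mono k01) (simp add: k01)
      then show "(k (w y) * w' y)\<^sup>2 \<le> k (w y) * w' y * w' y"
        by (simp add: power2_eq_square algebra_simps)
    qed
    finally show ?thesis .
  qed
  have "integral {0..1} (\<lambda>x. (P (w x))\<^sup>2) \<le>
      integral {0..1} (\<lambda>_::real. integral {0..1} (\<lambda>x. k (w x) * w' x * w' x))"
    using pt by (intro integral_le integrable_continuous_real continuous_intros ci) auto
  then show ?thesis using parts by simp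
qed

text \<open>The limit \<open>\<delta> \<rightarrow> 0\<close> of the previous inequality for the smoothed excess, which converges uniformly.\<close>

lemma diffusion_excess_le:
  fixes w w' w'' :: "real \<Rightarrow> real"
  assumes D: "D \<ge> 0"
    and w: "\<And>x. x \<in> {0..1} \<Longrightarrow> (w has_real_derivative w' x) (at x within {0..1})"
    and w': "\<And>x. x \<in> {0..1} \<Longrightarrow> (w' has_real_derivative w'' x) (at x within {0..1})"
    and w'': "continuous_on {0..1} w''"
    and bc: "\<bar>w 0\<bar> \<le> D" "\<bar>w 1\<bar> \<le> D"
  shows "integral {0..1} (\<lambda>x. excess D (w x) * w'' x) \<le> - integral {0..1} (\<lambda>x. (excess D (w x))\<^sup>2)"
proof -
  have cw: "continuous_on {0..1} w" using w by (rule DERIV_continuous_on)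
  have ce: "continuous_on {0..1} (\<lambda>x. excess D (w x))" by (intro continuous_intros cw)
  define I where "I = integral {0..1} (\<lambda>x. excess D (w x) * w'' x + (excess D (w x))\<^sup>2)"
  have "bounded (w'' ` {0..1})" "bounded ((\<lambda>x. excess D (w x)) ` {0..1})"
    by (intro compact_imp_bounded compact_continuous_image w'' ce compact_Icc)+
  then obtain A B where A: "\<And>x. x \<in> {0..1} \<Longrightarrow> \<bar>w'' x\<bar> \<le> A"
      and B: "\<And>x. x \<in> {0..1} \<Longrightarrow> \<bar>excess D (w x)\<bar> \<le> B"
    unfolding bounded_iff by (metis image_eqI real_norm_def)
  have approx: "I \<le> \<delta> * (A + 2 * B + 1)" if \<delta>: "0 < \<delta>" "\<delta> < 1" for \<delta>
  proof -
    obtain P k where P: "\<And>r. (P has_real_derivative k r) (at r)" "continuous_on UNIV k"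
        "\<And>r. 0 \<le> k r" "\<And>r. k r \<le> 1" and P0: "\<And>r. \<bar>r\<bar> \<le> D \<Longrightarrow> P r = 0"
        and Pe: "\<And>r. \<bar>excess D r - P r\<bar> \<le> \<delta>"
      using smooth_excess[OF D \<delta>(1)] by metis
    have "continuous_on UNIV P" using P(1) by (intro DERIV_continuous_on[where D = k]) auto
    then have cP: "continuous_on {0..1} (\<lambda>x. P (w x))"
      using continuous_on_compose2[OF _ cw] by blast
    have "I \<le> integral {0..1} (\<lambda>x. P (w x) * w'' x + (P (w x))\<^sup>2 + \<delta> * (A + 2 * B + 1))"
      unfolding I_def
    proof (intro integral_le integrable_continuous_real continuous_intros cw ce w'' cP)
      fix x :: real assume x: "x \<in> {0..1}"
      let ?e = "excess D (w x)" and ?P = "P (w x)"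
      have "?e * w'' x + ?e\<^sup>2 - (?P * w'' x + ?P\<^sup>2) = (?e - ?P) * (w'' x + ?e + ?P)"
        by (simp add: power2_eq_square algebra_simps)
      also have "\<dots> \<le> \<bar>?e - ?P\<bar> * \<bar>w'' x + ?e + ?P\<bar>"
        by (metis abs_ge_self abs_mult)
      also have "\<dots> \<le> \<delta> * (A + 2 * B + 1)"
        using A[OF x] B[OF x] Pe[of "w x"] \<delta> by (intro mult_mono) linarith+
      finally show "?e * w'' x + ?e\<^sup>2 \<le> ?P * w'' x + ?P\<^sup>2 + \<delta> * (A + 2 * B + 1)" by linarith
    qed
    also have "\<dots> = integral {0..1} (\<lambda>x. P (w x) * w'' x) + integral {0..1} (\<lambda>x. (P (w x))\<^sup>2)
        + \<delta> * (A + 2 * B + 1)"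
      by (subst integral_add integral_add;
          (intro integrable_continuous_real continuous_intros cw ce w'' cP)?)+ simp
    also have "\<dots> \<le> \<delta> * (A + 2 * B + 1)"
      using diffusion_C1_le[OF P w w' w'' P0[OF bc(1)] P0[OF bc(2)]] by simp
    finally show ?thesis .
  qed
  have "I \<le> 0"
  proof (rule tendsto_lowerbound)
    show "((\<lambda>\<delta>. \<delta> * (A + 2 * B + 1)) \<longlongrightarrow> 0) (at_right 0)"
      by (rule tendsto_eq_intros refl | simp)+
    show "\<forall>\<^sub>F \<delta> in at_right 0. I \<le> \<delta> * (A + 2 * B + 1)"
      using approx by (auto simp: eventually_at_right_field intro: exI[of _ 1])
  qed simp
  moreover have "I = integral {0..1} (\<lambda>x. excess D (w x) * w'' x) + integral {0..1} (\<lambda>x. (excess D (w x))\<^sup>2)"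
    unfolding I_def by (intro integral_add integrable_continuous_real continuous_intros ce w'')
  ultimately show ?thesis by simp
qed

text \<open>
  By substitution the integral equals that of \<open>r \<mapsto> excess D r * r\<close> between the two boundary
  values of \<open>w\<close>, and the excess vanishes on that range.
\<close>

lemma convection_excess_zero:
  assumes w: "\<And>x. x \<in> {0..1} \<Longrightarrow> (w has_real_derivative w' x) (at x within {0..1})"
    and bc: "\<bar>w 0\<bar> \<le> D" "\<bar>w 1\<bar> \<le> D"
  shows "((\<lambda>x. excess D (w x) * (w x * w' x)) has_integral 0) {0..1}"
proof -
  have cw: "continuous_on {0..1} w" using w by (rule DERIV_continuous_on)
  have "compact (w ` {0..1})" by (intro compact_continuous_image cw compact_Icc)
  then obtain c d where cd: "w ` {0..1} \<subseteq> {c..d}"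
    using compact_imp_bounded bounded_subset_cbox_symmetric
    by (metis box_real(2))
  have z: "integral {a..b} (\<lambda>r. excess D r * r) = 0" if "\<bar>a\<bar> \<le> D" "\<bar>b\<bar> \<le> D" for a b
  proof -
    have "excess D r * r = 0" if "r \<in> {a..b}" for r
      using that \<open>\<bar>a\<bar> \<le> D\<close> \<open>\<bar>b\<bar> \<le> D\<close> by (auto simp: excess_def)
    then show ?thesis by (metis (no_types, lifting) integral_eq_0_iff integral_cong integral_0)
  qed
  have "((\<lambda>x. w' x *\<^sub>R (excess D (w x) * w x)) has_integral
      (integral {w 0..w 1} (\<lambda>r. excess D r * r) - integral {w 1..w 0} (\<lambda>r. excess D r * r))) {0..1}"
    by (rule has_integral_substitution_general[OF finite.emptyI _ cd]) (use w cw in \<open>auto intro!: continuous_intros\<close>)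
  then show ?thesis unfolding z[OF bc] z[OF bc(2,1)] by (simp add: mult_ac)
qed

section \<open>Norms and regularity of the data\<close>

lemma set_lebesgue_integral_continuous:
  fixes g :: "real \<Rightarrow> real"
  assumes "continuous_on {a..b} g"
  shows "(LINT x:{a..b}|lebesgue. g x) = integral {a..b} g"
  by (intro set_lebesgue_integral_eq_integral absolutely_integrable_continuous_real assms)

lemma L2norm_sq:
  assumes "continuous_on {0..1} g"
  shows "(L2norm g)\<^sup>2 = integral {0..1} (\<lambda>x. (g x)\<^sup>2)"
proof -
  have "continuous_on {0..1} (\<lambda>x. (g x)\<^sup>2)" by (intro continuous_intros assms)
  then have "set_integrable lebesgue {0<..<1} (\<lambda>x. (g x)\<^sup>2)"
    by (intro set_integrable_subset[OF absolutely_integrable_continuous_real]) auto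
  then have "(LINT x:{0<..<1}|lebesgue. (g x)\<^sup>2) = integral {0..1} (\<lambda>x. (g x)\<^sup>2)"
    by (simp add: set_lebesgue_integral_eq_integral integral_open_interval_real)
  moreover have "0 \<le> integral {0..1} (\<lambda>x. (g x)\<^sup>2)"
    by (intro integral_nonneg integrable_continuous_real continuous_intros assms) simp
  ultimately show ?thesis by (simp add: L2norm_def)
qed

lemma L2norm_nonneg: "0 \<le> L2norm g"
  unfolding L2norm_def set_lebesgue_integral_def
  by (intro real_sqrt_ge_zero integral_nonneg_AE) auto

lemma holder_par_space_continuous:
  assumes "0 < \<theta>" and "f \<in> holder_par_space \<theta>"
  shows "continuous_on ({0..} \<times> {0..1}) (\<lambda>(t, x). f x t)"
proof -
  obtain A B where
    "\<forall>t\<ge>0. \<forall>x\<in>{0..1}. \<forall>y\<in>{0..1}. \<bar>f x t - f y t\<bar> \<le> A * \<bar>x - y\<bar> powr \<theta>"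
    "\<forall>x\<in>{0..1}. \<forall>s\<ge>0. \<forall>t\<ge>0. \<bar>f x s - f x t\<bar> \<le> B * \<bar>s - t\<bar> powr (\<theta> / 2)"
    using assms(2) unfolding holder_par_space_def by blast
  then have A: "\<bar>f x t - f y t\<bar> \<le> A * \<bar>x - y\<bar> powr \<theta>"
    and B: "\<bar>f x s - f x t\<bar> \<le> B * \<bar>s - t\<bar> powr (\<theta> / 2)"
    if "s \<ge> 0" "t \<ge> 0" "x \<in> {0..1}" "y \<in> {0..1}" for s t x y
    using that by blast+
  show ?thesis
    unfolding continuous_on_def
  proof
    fix q :: "real \<times> real" assume "q \<in> {0..} \<times> {0..1}"
    then obtain t x where q: "q = (t, x)" and tx: "t \<in> {0..}" "x \<in> {0..1}" by auto
    let ?F = "at (t, x) within {0..} \<times> {0..1}"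
    have t: "(fst \<longlongrightarrow> t) ?F" and x: "(snd \<longlongrightarrow> x) ?F"
      using tendsto_fst[OF tendsto_ident_at, of "(t, x)"] tendsto_snd[OF tendsto_ident_at, of "(t, x)"]
      by auto
    have lim: "((\<lambda>p. A * \<bar>snd p - x\<bar> powr \<theta> + B * \<bar>fst p - t\<bar> powr (\<theta> / 2)) \<longlongrightarrow> A * 0 + B * 0) ?F"
      using assms(1) by (intro tendsto_add tendsto_mult tendsto_const tendsto_zero_powrI[where b = \<theta>]
          tendsto_zero_powrI[where b = "\<theta> / 2"] tendsto_rabs_zero LIM_zero t x) auto
    have "((\<lambda>p. (case p of (t, x) \<Rightarrow> f x t) - f x t) \<longlongrightarrow> 0) ?F"
    proof (rule Lim_null_comparison)
      show "((\<lambda>p. A * \<bar>snd p - x\<bar> powr \<theta> + B * \<bar>fst p - t\<bar> powr (\<theta> / 2)) \<longlongrightarrow> 0) ?F"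
        using lim by simp
      have "norm ((case p of (t, x) \<Rightarrow> f x t) - f x t)
          \<le> A * \<bar>snd p - x\<bar> powr \<theta> + B * \<bar>fst p - t\<bar> powr (\<theta> / 2)"
        if "p \<in> {0..} \<times> {0..1}" for p
      proof -
        obtain s y where p: "p = (s, y)" and "0 \<le> s" "y \<in> {0..1}" using \<open>p \<in> {0..} \<times> {0..1}\<close> by auto
        then have "\<bar>f y s - f x s\<bar> \<le> A * \<bar>y - x\<bar> powr \<theta>" "\<bar>f x s - f x t\<bar> \<le> B * \<bar>s - t\<bar> powr (\<theta> / 2)"
          using tx A[of s s y x] B[of s t x x] by auto
        then show ?thesis by (simp add: p)
      qed
      then show "\<forall>\<^sub>F p in ?F. norm ((case p of (t, x) \<Rightarrow> f x t) - f x t)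
          \<le> A * \<bar>snd p - x\<bar> powr \<theta> + B * \<bar>fst p - t\<bar> powr (\<theta> / 2)"
        unfolding eventually_at_filter by (intro always_eventually) blast
    qed
    then show "((\<lambda>(t, x). f x t) \<longlongrightarrow> (case q of (t, x) \<Rightarrow> f x t)) (at q within {0..} \<times> {0..1})"
      unfolding q by (simp add: LIM_zero_iff)
  qed
qed

lemma has_real_derivative_deriv_within:
  assumes "g differentiable_on S" "x \<in> S"
  shows "(g has_real_derivative deriv_within S g x) (at x within S)"
  using assms unfolding differentiable_on_def deriv_within_def
  by (simp add: has_real_derivative_iff_has_vector_derivative vector_derivative_works)

lemma continuous_on_swap_args:
  assumes "continuous_on (A \<times> B) (\<lambda>(x, t). g x t)"
  shows "continuous_on (B \<times> A) (\<lambda>(t, x). g x t)"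
proof -
  have "prod.swap ` (B \<times> A) \<subseteq> A \<times> B" by auto
  from continuous_on_compose2[OF assms continuous_on_swap this] show ?thesis
    by (simp add: case_prod_unfold)
qed

lemma continuous_on_section:
  assumes "continuous_on (A \<times> B) (\<lambda>(t, x). g t x)" "t \<in> A"
  shows "continuous_on B (g t)"
proof -
  have "continuous_on B (\<lambda>x. (t, x))" "(\<lambda>x. (t, x)) ` B \<subseteq> A \<times> B"
    using assms(2) by (auto intro!: continuous_intros)
  from continuous_on_compose2[OF assms(1) this] show ?thesis by simp
qed

lemma continuous_on_integral_sq:
  fixes f :: "real \<Rightarrow> real \<Rightarrow> real"
  assumes "continuous_on (A \<times> {0..1}) (\<lambda>(t, x). f x t)"
  shows "continuous_on A (\<lambda>t. integral {0..1} (\<lambda>x. (f x t)\<^sup>2))"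
proof -
  have "continuous_on (A \<times> cbox 0 1) (\<lambda>(t, x). (f x t)\<^sup>2)"
    using continuous_on_power[OF assms, of 2] by (simp add: case_prod_unfold)
  from integral_continuous_on_param[OF this] show ?thesis by simp
qed

lemma abs_le_SUP_Icc:
  fixes d :: "real \<Rightarrow> real"
  assumes "bounded (d ` {0..})" "t \<in> {0..T}"
  shows "\<bar>d t\<bar> \<le> (SUP s\<in>{0..T}. \<bar>d s\<bar>)"
proof (rule cSUP_upper[OF assms(2)])
  obtain B where "\<And>t. t \<ge> 0 \<Longrightarrow> \<bar>d t\<bar> \<le> B"
    using assms(1) unfolding bounded_iff by auto
  then show "bdd_above ((\<lambda>s. \<bar>d s\<bar>) ` {0..T})" by (intro bdd_aboveI2) auto
qed

section \<open>Energy estimate along solutions\<close>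

text \<open>
  Dropping the factor \<open>exp (- a * (T - s)) \<le> 1\<close> from the variation-of-constants formula leaves the plain
  integral of the forcing.  Accordingly the nonincreasing quantity \<open>H\<close> below carries the constant
  weight \<open>exp (a * T)\<close> in front of that integral.
\<close>

lemma gronwall_forced:
  fixes E F :: "real \<Rightarrow> real"
  assumes "0 \<le> T" "0 \<le> a" and F: "continuous_on {0..T} F" "\<And>t. t \<in> {0..T} \<Longrightarrow> 0 \<le> F t"
    and E: "continuous_on {0..T} E"
      "\<And>t. 0 < t \<Longrightarrow> t < T \<Longrightarrow> (E has_real_derivative E' t) (at t)"
      "\<And>t. 0 < t \<Longrightarrow> t < T \<Longrightarrow> E' t \<le> - a * E t + F t"
  shows "E T \<le> E 0 * exp (- a * T) + integral {0..T} F"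
proof -
  define H where "H t = exp (a * t) * E t - exp (a * T) * integral {0..t} F" for t
  have iF: "((\<lambda>t. integral {0..t} F) has_real_derivative F t) (at t within {0..T})" if "t \<in> {0..T}" for t
    using integral_has_real_derivative[OF F(1) that] .
  then have cF: "continuous_on {0..T} (\<lambda>t. integral {0..t} F)"
    by (rule DERIV_continuous_on)
  have "H T \<le> H 0"
  proof (cases "T = 0")
    case False
    then have "0 < T" using \<open>0 \<le> T\<close> by simp
    then show ?thesis
    proof (rule DERIV_nonpos_imp_decreasing_open[OF less_imp_le])
      show "continuous_on {0..T} H"
        unfolding H_def by (intro continuous_intros E(1) cF)
      fix t assume t: "0 < t" "t < T"
      have "at t within {0..T} = at t" using t by (intro at_within_interior) auto
      then have dF: "((\<lambda>t. integral {0..t} F) has_real_derivative F t) (at t)"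
        using iF[of t] t by simp
      have "(H has_real_derivative (exp (a * t) * a * E t + exp (a * t) * E' t - exp (a * T) * F t)) (at t)"
        unfolding H_def by (rule derivative_eq_intros E(2)[OF t] dF refl)+ (simp add: algebra_simps)
      moreover have "exp (a * t) * (E' t + a * E t) \<le> exp (a * T) * F t"
      proof -
        have "exp (a * t) * (E' t + a * E t) \<le> exp (a * t) * F t"
          using E(3)[OF t] by (intro mult_left_mono) auto
        also have "\<dots> \<le> exp (a * T) * F t"
          using t \<open>0 \<le> a\<close> by (intro mult_right_mono F(2)) (auto intro: mult_left_mono)
        finally show ?thesis .
      qed
      ultimately show "\<exists>y. (H has_real_derivative y) (at t) \<and> y \<le> 0"
        by (intro exI conjI) (assumption, simp add: algebra_simps)
    qed
  qed simp
  then have "exp (a * T) * (E T - integral {0..T} F) \<le> E 0"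
    by (simp add: H_def algebra_simps)
  then have "exp (- a * T) * (exp (a * T) * (E T - integral {0..T} F)) \<le> exp (- a * T) * E 0"
    by (intro mult_left_mono) auto
  moreover have "exp (- a * T) * exp (a * T) = 1"
    by (simp flip: exp_add)
  ultimately show ?thesis by (simp only: mult.assoc[symmetric]) (simp add: mult.commute)
qed

context
  fixes \<mu> \<nu> :: real and u0 d :: "real \<Rightarrow> real" and f u :: "real \<Rightarrow> real \<Rightarrow> real"
  assumes sol: "burgers_solution \<mu> \<nu> u0 d f u"
begin

lemma solution_Dx:
  assumes "t \<ge> 0" "x \<in> {0..1}"
  shows "((\<lambda>x. u x t) has_real_derivative Dx u x t) (at x within {0..1})"
    and "((\<lambda>x. Dx u x t) has_real_derivative Dx (Dx u) x t) (at x within {0..1})"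
  using sol assms unfolding burgers_solution_def C21_def Dx_def
  by (auto intro!: has_real_derivative_deriv_within)

lemma solution_Dt:
  assumes "t \<ge> 0" "x \<in> {0..1}"
  shows "((\<lambda>t. u x t) has_real_derivative Dt u x t) (at t within {0..})"
  using sol assms unfolding burgers_solution_def C21_def Dt_def
  by (auto intro!: has_real_derivative_deriv_within)

lemma solution_continuous:
  "continuous_on ({0..} \<times> {0..1}) (\<lambda>(t, x). u x t)"
  "continuous_on ({0..} \<times> {0..1}) (\<lambda>(t, x). Dx u x t)"
  "continuous_on ({0..} \<times> {0..1}) (\<lambda>(t, x). Dx (Dx u) x t)"
  "continuous_on ({0..} \<times> {0..1}) (\<lambda>(t, x). Dt u x t)"
  by (rule continuous_on_swap_args, use sol in \<open>simp add: burgers_solution_def C21_def\<close>)+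

lemma excess_energy_deriv:
  assumes D: "D \<ge> 0" and "t \<ge> 0"
  shows "((\<lambda>t. integral {0..1} (\<lambda>x. (excess D (u x t))\<^sup>2)) has_real_derivative
      integral {0..1} (\<lambda>x. 2 * excess D (u x t) * Dt u x t)) (at t within {0..})"
proof -
  have "((\<lambda>t. integral (cbox 0 1) (\<lambda>x. (excess D (u x t))\<^sup>2)) has_real_derivative
      integral (cbox 0 1) (\<lambda>x. 2 * excess D (u x t) * Dt u x t)) (at t within {0..})"
  proof (rule leibniz_rule_field_derivative)
    fix t x :: real assume "t \<in> {0..}" "x \<in> cbox 0 1"
    then show "((\<lambda>t. (excess D (u x t))\<^sup>2) has_real_derivative 2 * excess D (u x t) * Dt u x t)
        (at t within {0..})"
      using DERIV_chain2[OF has_real_derivative_excess_sq[OF D] solution_Dt] by simp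
  next
    fix t :: real assume "t \<in> {0..}"
    then have "continuous_on {0..1} (\<lambda>x. u x t)"
      using continuous_on_section[OF solution_continuous(1)] by blast
    then show "(\<lambda>x. (excess D (u x t))\<^sup>2) integrable_on cbox 0 1"
      by (auto intro!: integrable_continuous_real continuous_intros)
  next
    show "continuous_on ({0..} \<times> cbox 0 1) (\<lambda>(t, x). 2 * excess D (u x t) * Dt u x t)"
      using solution_continuous(1,4) unfolding case_prod_unfold
      by (auto intro!: continuous_intros)
  qed (use assms in auto)
  then show ?thesis by simp
qed

text \<open>
  This is the equation tested with \<open>2 * excess D u\<close>.  Convection drops out and diffusion contributes
  the decay rate \<open>2 * \<mu>\<close>; Young's inequality for the source spends \<open>\<epsilon>\<close> of it, and the rate in the
  statement is smaller than the resulting \<open>2 * \<mu> - \<epsilon>\<close>.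
\<close>

lemma excess_energy_deriv_le:
  assumes "\<mu> > 0" and D: "D \<ge> 0" and t: "t > 0" and bd: "\<bar>d t\<bar> \<le> D" and \<epsilon>: "\<epsilon> > 0"
    and f: "continuous_on {0..1} (\<lambda>x. f x t)"
  shows "integral {0..1} (\<lambda>x. 2 * excess D (u x t) * Dt u x t) \<le>
      - (\<mu> - \<epsilon>) * integral {0..1} (\<lambda>x. (excess D (u x t))\<^sup>2) + integral {0..1} (\<lambda>x. (f x t)\<^sup>2) / \<epsilon>"
proof -
  let ?p = "\<lambda>x. excess D (u x t)"
  define E where "E = integral {0..1} (\<lambda>x. (?p x)\<^sup>2)"
  have c: "continuous_on {0..1} (\<lambda>x. u x t)" "continuous_on {0..1} (\<lambda>x. Dx u x t)"
      "continuous_on {0..1} (\<lambda>x. Dx (Dx u) x t)" "continuous_on {0..1} (\<lambda>x. Dt u x t)"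
    using solution_continuous[THEN continuous_on_section, of t] t by simp_all
  note ci = integrable_continuous_real continuous_intros c f
  have bc: "\<bar>u 0 t\<bar> \<le> D" "\<bar>u 1 t\<bar> \<le> D"
    using sol t bd D unfolding burgers_solution_def by auto
  have E0: "0 \<le> E" unfolding E_def by (intro integral_nonneg ci) simp
  have diff: "integral {0..1} (\<lambda>x. ?p x * Dx (Dx u) x t) \<le> - E"
    unfolding E_def
    by (rule diffusion_excess_le[OF D solution_Dx]) (use t bc c in auto)
  have conv: "((\<lambda>x. ?p x * (u x t * Dx u x t)) has_integral 0) {0..1}"
    by (rule convection_excess_zero[OF solution_Dx(1)]) (use t bc in auto)
  \<comment> \<open>The equation holds in the open interval; its endpoints do not contribute to the integral.\<close>
  have "integral {0..1} (\<lambda>x. 2 * ?p x * Dt u x t) =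
      integral {0..1} (\<lambda>x. 2 * \<mu> * (?p x * Dx (Dx u) x t) - 2 * \<nu> * (?p x * (u x t * Dx u x t))
         + 2 * ?p x * f x t)"
    unfolding integral_open_interval_real
  proof (rule integral_cong)
    fix x :: real assume "x \<in> {0<..<1}"
    then have "Dt u x t = \<mu> * Dx (Dx u) x t - \<nu> * u x t * Dx u x t + f x t"
      using sol t unfolding burgers_solution_def by (auto simp: algebra_simps)
    then show "2 * ?p x * Dt u x t = 2 * \<mu> * (?p x * Dx (Dx u) x t)
        - 2 * \<nu> * (?p x * (u x t * Dx u x t)) + 2 * ?p x * f x t"
      by (simp only:) (simp add: algebra_simps)
  qed
  also have "\<dots> = 2 * \<mu> * integral {0..1} (\<lambda>x. ?p x * Dx (Dx u) x t) - 2 * \<nu> * 0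
      + integral {0..1} (\<lambda>x. 2 * ?p x * f x t)"
    by (intro integral_unique has_integral_add has_integral_diff has_integral_mult_right conv
        integrable_integral ci)
  also have "\<dots> \<le> 2 * \<mu> * - E + integral {0..1} (\<lambda>x. 2 * ?p x * f x t)"
    using mult_left_mono[OF diff, of "2 * \<mu>"] \<open>\<mu> > 0\<close> by simp
  also have "integral {0..1} (\<lambda>x. 2 * ?p x * f x t) \<le>
      integral {0..1} (\<lambda>x. \<epsilon> * (?p x)\<^sup>2 + (f x t)\<^sup>2 / \<epsilon>)"
  proof (intro integral_le ci)
    fix x
    have "0 \<le> (\<epsilon> * ?p x - f x t)\<^sup>2 / \<epsilon>" using \<epsilon> by simp
    also have "\<dots> = \<epsilon> * (?p x)\<^sup>2 + (f x t)\<^sup>2 / \<epsilon> - 2 * ?p x * f x t"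
      using \<epsilon> by (simp add: power2_eq_square field_simps)
    finally show "2 * ?p x * f x t \<le> \<epsilon> * (?p x)\<^sup>2 + (f x t)\<^sup>2 / \<epsilon>" by simp
  qed (use \<epsilon> in auto)
  also have "\<dots> = \<epsilon> * E + integral {0..1} (\<lambda>x. (f x t)\<^sup>2) / \<epsilon>"
    unfolding E_def
    by (intro integral_unique has_integral_add has_integral_mult_right has_integral_divide
        integrable_integral ci)
  finally have "integral {0..1} (\<lambda>x. 2 * ?p x * Dt u x t) \<le>
      - (2 * \<mu> - \<epsilon>) * E + integral {0..1} (\<lambda>x. (f x t)\<^sup>2) / \<epsilon>"
    by (simp add: algebra_simps)
  moreover have "0 \<le> \<mu> * E" using E0 \<open>\<mu> > 0\<close> by simp
  ultimately show ?thesis unfolding E_def by (simp add: algebra_simps)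
qed

lemma excess_energy_decay:
  assumes "\<mu> > 0" "D \<ge> 0" "T \<ge> 0" "0 < \<epsilon>" "\<epsilon> < \<mu>"
    and bd: "\<And>t. t \<in> {0..T} \<Longrightarrow> \<bar>d t\<bar> \<le> D"
    and f: "continuous_on ({0..} \<times> {0..1}) (\<lambda>(t, x). f x t)"
  shows "integral {0..1} (\<lambda>x. (excess D (u x T))\<^sup>2) \<le>
      integral {0..1} (\<lambda>x. (excess D (u x 0))\<^sup>2) * exp (- (\<mu> - \<epsilon>) * T) +
      integral {0..T} (\<lambda>s. integral {0..1} (\<lambda>x. (f x s)\<^sup>2)) / \<epsilon>"
proof -
  define E where "E t = integral {0..1} (\<lambda>x. (excess D (u x t))\<^sup>2)" for t
  define F where "F t = integral {0..1} (\<lambda>x. (f x t)\<^sup>2)" for t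
  have fs: "continuous_on {0..1} (\<lambda>x. f x t)" if "t \<ge> 0" for t
    using continuous_on_section[OF f] that by simp
  have F: "continuous_on {0..} F"
    unfolding F_def by (rule continuous_on_integral_sq[OF f])
  then have FT: "continuous_on {0..T} F" by (rule continuous_on_subset) auto
  have "continuous_on {0..} E"
    unfolding E_def using excess_energy_deriv[OF \<open>D \<ge> 0\<close>] by (intro DERIV_continuous_on) auto
  then have ET: "continuous_on {0..T} E" by (rule continuous_on_subset) auto
  have "E T \<le> E 0 * exp (- (\<mu> - \<epsilon>) * T) + integral {0..T} (\<lambda>t. F t / \<epsilon>)"
  proof (rule gronwall_forced[OF \<open>T \<ge> 0\<close> _ _ _ ET])
    show "continuous_on {0..T} (\<lambda>t. F t / \<epsilon>)"
      using \<open>0 < \<epsilon>\<close> by (intro continuous_intros FT) auto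
    show "0 \<le> F t / \<epsilon>" if "t \<in> {0..T}" for t
      using that \<open>0 < \<epsilon>\<close> unfolding F_def
      by (intro divide_nonneg_pos integral_nonneg integrable_continuous_real continuous_intros fs) auto
    fix t assume t: "0 < t" "t < T"
    have "at t within {0..} = at t" using t by (intro at_within_interior) auto
    then show "(E has_real_derivative integral {0..1} (\<lambda>x. 2 * excess D (u x t) * Dt u x t)) (at t)"
      unfolding E_def using excess_energy_deriv[OF \<open>D \<ge> 0\<close>, of t] t by simp
    show "integral {0..1} (\<lambda>x. 2 * excess D (u x t) * Dt u x t) \<le> - (\<mu> - \<epsilon>) * E t + F t / \<epsilon>"
      unfolding E_def F_def using assms t by (intro excess_energy_deriv_le fs) auto
  qed (use assms in auto)
  then show ?thesis unfolding E_def F_def by simp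
qed

lemma L2_estimate:
  assumes "\<mu> > 0" "T \<ge> 0" "0 < \<epsilon>" "\<epsilon> < \<mu>"
    and d: "bounded (d ` {0..})"
    and f: "continuous_on ({0..} \<times> {0..1}) (\<lambda>(t, x). f x t)"
  shows "(L2norm (\<lambda>x. u x T))\<^sup>2 \<le>
      2 * (L2norm u0)\<^sup>2 * exp (- (\<mu> - \<epsilon>) * T) + 2 * (SUP s\<in>{0..T}. \<bar>d s\<bar>)\<^sup>2 +
      2 / \<epsilon> * (LINT s:{0..T}|lebesgue. (L2norm (\<lambda>x. f x s))\<^sup>2)"
proof -
  define D where "D = (SUP s\<in>{0..T}. \<bar>d s\<bar>)"
  have dD: "\<bar>d t\<bar> \<le> D" if "t \<in> {0..T}" for t
    unfolding D_def using d that by (rule abs_le_SUP_Icc)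
  have D0: "D \<ge> 0" using dD[of 0] \<open>T \<ge> 0\<close> by simp
  have fs: "continuous_on {0..1} (\<lambda>x. f x t)" if "t \<ge> 0" for t
    using continuous_on_section[OF f] that by simp
  have us: "continuous_on {0..1} (\<lambda>x. u x t)" if "t \<ge> 0" for t
    using continuous_on_section[OF solution_continuous(1)] that by simp
  note ci = integrable_continuous_real continuous_intros us
  have u0: "u x 0 = u0 x" if "x \<in> {0..1}" for x
    using sol that unfolding burgers_solution_def by auto
  have cu0: "continuous_on {0..1} u0"
    using us[of 0] continuous_on_cong[of "{0..1}" "{0..1}" u0 "\<lambda>x. u x 0"] u0 by simp
  have "continuous_on {0..T} (\<lambda>t. integral {0..1} (\<lambda>x. (f x t)\<^sup>2))"
    by (rule continuous_on_subset[OF continuous_on_integral_sq[OF f]]) auto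
  from set_lebesgue_integral_continuous[OF this]
  have "integral {0..T} (\<lambda>s. integral {0..1} (\<lambda>x. (f x s)\<^sup>2)) =
      (LINT s:{0..T}|lebesgue. integral {0..1} (\<lambda>x. (f x s)\<^sup>2))" by simp
  also have "\<dots> = (LINT s:{0..T}|lebesgue. (L2norm (\<lambda>x. f x s))\<^sup>2)"
    by (intro set_lebesgue_integral_cong) (auto simp: L2norm_sq fs)
  finally have F: "integral {0..T} (\<lambda>s. integral {0..1} (\<lambda>x. (f x s)\<^sup>2)) =
      (LINT s:{0..T}|lebesgue. (L2norm (\<lambda>x. f x s))\<^sup>2)" .
  have "integral {0..1} (\<lambda>x. (excess D (u x 0))\<^sup>2) \<le> integral {0..1} (\<lambda>x. (u x 0)\<^sup>2)"
    by (intro integral_le ci excess_bounds(2)[OF D0]) auto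
  also have "\<dots> = (L2norm u0)\<^sup>2"
    unfolding L2norm_sq[OF cu0] by (rule integral_cong) (simp add: u0)
  finally have init: "integral {0..1} (\<lambda>x. (excess D (u x 0))\<^sup>2) * exp (- (\<mu> - \<epsilon>) * T)
      \<le> (L2norm u0)\<^sup>2 * exp (- (\<mu> - \<epsilon>) * T)"
    by (rule mult_right_mono) simp
  have "(L2norm (\<lambda>x. u x T))\<^sup>2 = integral {0..1} (\<lambda>x. (u x T)\<^sup>2)"
    using \<open>T \<ge> 0\<close> by (intro L2norm_sq us)
  also have "\<dots> \<le> integral {0..1} (\<lambda>x. 2 * (excess D (u x T))\<^sup>2 + 2 * D\<^sup>2)"
    using \<open>T \<ge> 0\<close> by (intro integral_le ci excess_bounds(1)[OF D0]) auto
  also have "\<dots> = integral {0..1} (\<lambda>x. 2 * (excess D (u x T))\<^sup>2) + integral {0..1} (\<lambda>x::real. 2 * D\<^sup>2)"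
    using \<open>T \<ge> 0\<close> by (intro integral_add ci)
  also have "\<dots> = 2 * integral {0..1} (\<lambda>x. (excess D (u x T))\<^sup>2) + 2 * D\<^sup>2"
    by simp
  finally show ?thesis
    using excess_energy_decay[OF \<open>\<mu> > 0\<close> D0 \<open>T \<ge> 0\<close> assms(3,4) dD f] init
    unfolding F D_def[symmetric] times_divide_eq_left by linarith
qed

end

section \<open>Comparison functions and stability\<close>

lemma linear_class_Kinf: "c > 0 \<Longrightarrow> (\<lambda>s. c * s) \<in> class_Kinf"
  unfolding class_Kinf_def class_K_def
  by (auto intro!: continuous_intros strict_mono_onI filterlim_tendsto_pos_mult_at_top[OF tendsto_const]
      filterlim_ident)

lemma sqrt_linear_class_Kinf:
  assumes "c > 0" shows "(\<lambda>s. sqrt (c * s)) \<in> class_Kinf"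
proof -
  have "filterlim (\<lambda>s. sqrt (c * s)) at_top at_top"
    using filterlim_compose[OF sqrt_at_top] linear_class_Kinf[OF assms]
    unfolding class_Kinf_def by blast
  then show ?thesis
    using assms unfolding class_Kinf_def class_K_def
    by (auto intro!: continuous_intros strict_mono_onI)
qed

lemma power2_class_K: "(\<lambda>s. s\<^sup>2) \<in> class_K"
  unfolding class_K_def by (auto intro!: continuous_intros strict_mono_onI power_strict_mono)

lemma exp_decay_class_KL:
  assumes "a > 0" "c > 0"
  shows "(\<lambda>s t. a * s * exp (- c * t)) \<in> class_KL"
proof -
  have "(\<lambda>s. a * s * exp (- c * t)) \<in> class_K" for t
    using linear_class_Kinf[of "a * exp (- c * t)"] assms
    by (simp add: class_Kinf_def mult_ac)
  moreover have "(\<lambda>t. a * s * exp (- c * t)) \<in> class_L" if "s > 0" for s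
  proof -
    have "filterlim (\<lambda>t. - c * t) at_bot at_top"
      by (rule filterlim_tendsto_neg_mult_at_bot[OF tendsto_const _ filterlim_ident]) (use assms in simp)
    then have "((\<lambda>t. exp (- c * t)) \<longlongrightarrow> 0) at_top"
      by (rule filterlim_compose[OF exp_at_bot])
    from tendsto_mult[OF tendsto_const[of "a * s"] this]
    show ?thesis
      using assms that unfolding class_L_def monotone_on_def
      by (auto intro!: continuous_intros)
  qed
  ultimately show ?thesis unfolding class_KL_def by simp
qed

theorem theorem5:
  fixes \<mu> \<nu> \<theta> :: real
  assumes "\<mu> > 0" and "\<nu> > 0" and "0 < \<theta>" and "\<theta> < 1"
  shows "EISS_EiISS_L2 (\<lambda>u0 d f u. admissible_data \<theta> u0 d f \<and>
            (SUP t\<in>{0..}. \<bar>d t\<bar>) < \<mu> / \<nu> \<and> burgers_solution \<mu> \<nu> u0 d f u) \<and>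
         (\<forall>u0 d f u. admissible_data \<theta> u0 d f \<longrightarrow> (SUP t\<in>{0..}. \<bar>d t\<bar>) < \<mu> / \<nu> \<longrightarrow>
            burgers_solution \<mu> \<nu> u0 d f u \<longrightarrow>
            (\<forall>t>0. \<forall>\<epsilon>\<in>{0<..<\<mu>}.
               (L2norm (\<lambda>x. u x t))\<^sup>2 \<le>
                 2 * (L2norm u0)\<^sup>2 * exp (- (\<mu> - \<epsilon>) * t) +
                 2 * (SUP s\<in>{0..t}. \<bar>d s\<bar>)\<^sup>2 +
                 2 / \<epsilon> * (LINT s:{0..t}|lebesgue. (L2norm (\<lambda>x. f x s))\<^sup>2)))"
proof
  have data: "bounded (d ` {0..})" "continuous_on ({0..} \<times> {0..1}) (\<lambda>(t, x). f x t)"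
    if "admissible_data \<theta> u0 d f" for u0 d f
    using that holder_par_space_continuous[OF \<open>0 < \<theta>\<close>]
    by (auto simp: admissible_data_def holder_1_space_def)
  show "\<forall>u0 d f u. admissible_data \<theta> u0 d f \<longrightarrow> (SUP t\<in>{0..}. \<bar>d t\<bar>) < \<mu> / \<nu> \<longrightarrow>
            burgers_solution \<mu> \<nu> u0 d f u \<longrightarrow>
            (\<forall>t>0. \<forall>\<epsilon>\<in>{0<..<\<mu>}.
               (L2norm (\<lambda>x. u x t))\<^sup>2 \<le>
                 2 * (L2norm u0)\<^sup>2 * exp (- (\<mu> - \<epsilon>) * t) +
                 2 * (SUP s\<in>{0..t}. \<bar>d s\<bar>)\<^sup>2 +
                 2 / \<epsilon> * (LINT s:{0..t}|lebesgue. (L2norm (\<lambda>x. f x s))\<^sup>2))"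
    using L2_estimate data \<open>\<mu> > 0\<close> by simp
  let ?\<beta> = "\<lambda>s t. sqrt 2 * s * exp (- (\<mu> / 4) * t)"
  let ?\<eta> = "\<lambda>s. sqrt (4 / \<mu> * s)"
  show "EISS_EiISS_L2 (\<lambda>u0 d f u. admissible_data \<theta> u0 d f \<and>
            (SUP t\<in>{0..}. \<bar>d t\<bar>) < \<mu> / \<nu> \<and> burgers_solution \<mu> \<nu> u0 d f u)"
    unfolding EISS_EiISS_L2_def
  proof (rule bexI[of _ ?\<beta>], rule bexI[of _ ?\<eta>], rule bexI[of _ "\<lambda>s. sqrt 2 * s"],
      rule bexI[of _ "\<lambda>s. s\<^sup>2"], intro conjI bexI[of _ "\<lambda>s. sqrt 2 * s"] exI[of _ "\<mu> / 4"])
    show "?\<beta> \<in> class_KL" using \<open>\<mu> > 0\<close> by (intro exp_decay_class_KL) auto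
    show "?\<eta> \<in> class_Kinf" using \<open>\<mu> > 0\<close> by (intro sqrt_linear_class_Kinf) auto
    show "(\<lambda>s. sqrt 2 * s) \<in> class_Kinf" by (intro linear_class_Kinf) auto
    then show "(\<lambda>s. sqrt 2 * s) \<in> class_K" by (simp add: class_Kinf_def)
    show "(\<lambda>s. s\<^sup>2) \<in> class_K" by (rule power2_class_K)
    show "\<mu> / 4 > 0" using \<open>\<mu> > 0\<close> by simp
    show "\<forall>s\<ge>0. \<forall>t\<ge>0. ?\<beta> s t \<le> sqrt 2 * s * exp (- (\<mu> / 4) * t)" by simp
    show "ISS_iISS_L2_estimate (\<lambda>u0 d f u. admissible_data \<theta> u0 d f \<and>
            (SUP t\<in>{0..}. \<bar>d t\<bar>) < \<mu> / \<nu> \<and> burgers_solution \<mu> \<nu> u0 d f u)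
          ?\<beta> (\<lambda>s. sqrt 2 * s) ?\<eta> (\<lambda>s. s\<^sup>2)"
      unfolding ISS_iISS_L2_estimate_def
    proof (intro allI impI)
      fix u0 d f u and t :: real
      assume A: "admissible_data \<theta> u0 d f \<and> (SUP t\<in>{0..}. \<bar>d t\<bar>) < \<mu> / \<nu> \<and>
          burgers_solution \<mu> \<nu> u0 d f u" and t: "t \<ge> 0"
      let ?N = "L2norm u0" and ?D = "SUP s\<in>{0..t}. \<bar>d s\<bar>"
        and ?I = "LINT s:{0..t}|lebesgue. (L2norm (\<lambda>x. f x s))\<^sup>2"
      have "\<bar>d 0\<bar> \<le> ?D" using A t data by (intro abs_le_SUP_Icc) auto
      then have D: "0 \<le> ?D" by linarith
      have I: "0 \<le> ?I"
        unfolding set_lebesgue_integral_def by (intro integral_nonneg_AE) auto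
      have half: "exp (- (\<mu> - \<mu> / 2) * t) = (exp (- (\<mu> / 4) * t))\<^sup>2"
        by (simp add: field_simps flip: exp_double)
      \<comment> \<open>With \<open>\<epsilon> = \<mu>/2\<close> the squared norm decays at rate \<open>\<mu>/2\<close>, hence the norm at rate \<open>\<mu>/4\<close>.\<close>
      have "(L2norm (\<lambda>x. u x t))\<^sup>2 \<le> 2 * ?N\<^sup>2 * exp (- (\<mu> - \<mu> / 2) * t) + 2 * ?D\<^sup>2 + 2 / (\<mu> / 2) * ?I"
        using A t data \<open>\<mu> > 0\<close> by (intro L2_estimate) auto
      also have "\<dots> = (?\<beta> ?N t)\<^sup>2 + (sqrt 2 * ?D)\<^sup>2 + (?\<eta> ?I)\<^sup>2"
        unfolding half using I \<open>\<mu> > 0\<close> by (simp add: power_mult_distrib)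
      also have "\<dots> \<le> (?\<beta> ?N t + sqrt 2 * ?D + ?\<eta> ?I)\<^sup>2"
      proof -
        have sq: "a\<^sup>2 + b\<^sup>2 + c\<^sup>2 \<le> (a + b + c)\<^sup>2" if "0 \<le> a" "0 \<le> b" "0 \<le> c" for a b c :: real
          using that by (simp add: power2_eq_square algebra_simps)
        show ?thesis using D I \<open>\<mu> > 0\<close> by (intro sq) (auto simp: L2norm_nonneg)
      qed
      finally show "L2norm (\<lambda>x. u x t) \<le> ?\<beta> ?N t + sqrt 2 * ?D + ?\<eta> ?I"
        by (rule power2_le_imp_le) (use D I \<open>\<mu> > 0\<close> in \<open>auto simp: L2norm_nonneg\<close>)
    qed
  qed
qed

end
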